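(* Let $p\in\mathbb{C}$, $y_p(x)=\frac{e^{px}-1}{p}e^{-x}$ (with $y_0=xe^{-x}$), and let $\mathfrak{T}f=f/f'$ for $f\in x+x^2\mathbb{C}[[x]]$. Then, as formal power series in $x$ with coefficients polynomial in $\alpha$: $$\frac{e^{\alpha (y_p)^{inv}(x)}-1}{\alpha}=\sum_{n=1}^\infty\frac{p^{n-1}x^n}{n}\binom{\frac{\alpha+n}{p}-1}{n-1},$$ $$\frac{e^{\alpha(\mathfrak{T}y_p)^{inv}(x)}-1}{\alpha}=\sum_{n=1}^\infty\frac{x^n}{n}\sum_{k=0}^{n-1}\binom{\frac\alpha p-1}{k}\binom{n}{k+1}p^k(p-1)^{n-1-k},$$ $$\frac{e^{\alpha(\mathfrak{T}^2y_p)^{inv}(x)}-1}{\alpha}=\sum_{n=1}^\infty\frac{x^n}{n}\sum_{k=0}^{n-1}\binom{\frac\alpha p+n-1}{k}\binom{2n-k-2}{n-1}p^k(1-p)^{n-1-k},$$ $$\frac{e^{\alpha(y_py_p')^{inv}(x)}-1}{\alpha}=\sum_{n=1}^\infty\frac{x^n}{n}\sum_{k=0}^{n-1}\binom{\frac{\alpha+2n-p}{p}}{k}\binom{2n-k-2}{n-1}p^k(1-p)^{n-1-k}.$$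
   Context: $f^{inv}$ denotes the compositional inverse of $f\in x+x^2\mathbb{C}[[x]]$, and $\mathfrak{T}^2=\mathfrak{T}\circ\mathfrak{T}$. For a complex (or polynomial) $z$, $\binom zk=\frac{z(z-1)\cdots(z-k+1)}{k!}$. Products $\binom{z/p+c}{k}p^k$ are read as $\frac1{k!}\prod_{j=0}^{k-1}(z+(c-j)p)$, which makes sense also for $p=0$. The convention $0^0=1$ is used. *)

theory Defs
  imports "HOL-Computational_Algebra.Computational_Algebra"
begin

definition y_series :: "complex \<Rightarrow> complex fps" where
  "y_series p = (if p = 0 then fps_X * fps_exp (-1)
          else fps_const (1 / p) * (fps_exp p - 1) * fps_exp (-1))"

definition \<TT> :: "complex fps \<Rightarrow> complex fps" where
  "\<TT> f = f / fps_deriv f"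

text \<open>Power series in \<open>x\<close> with coefficients in \<open>\<complex>[\<alpha>]\<close> have type \<open>complex poly fps\<close>.\<close>

abbreviation \<alpha> :: "complex poly" where
  "\<alpha> \<equiv> [:0, 1:]"

definition const_coeffs :: "complex fps \<Rightarrow> complex poly fps" where
  "const_coeffs g = Abs_fps (\<lambda>n. [:fps_nth g n:])"

text \<open>The library's \<open>fps_exp\<close> requires coefficients in a field, so \<open>e\<^bsup>\<alpha>x\<^esup>\<close> over \<open>\<complex>[\<alpha>]\<close> is
  written out as the series with coefficients \<open>\<alpha>\<^sup>n / n!\<close>.\<close>

definition exp_\<alpha> :: "complex poly fps" where
  "exp_\<alpha> = Abs_fps (\<lambda>n. smult (1 / fact n) (\<alpha> ^ n))"

text \<open>\<open>(e\<^bsup>\<alpha> g(x)\<^esup> - 1) / \<alpha>\<close> for \<open>g\<close> with \<open>g(0) = 0\<close>. The polynomial divisions by \<open>\<alpha>\<close> are exact,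
  see the lemma \<open>exp_quotient_exact\<close>.\<close>

definition exp_quotient :: "complex fps \<Rightarrow> complex poly fps" where
  "exp_quotient g =
     Abs_fps (\<lambda>n. fps_nth (fps_compose exp_\<alpha> (const_coeffs g) - 1) n div \<alpha>)"

lemma exp_quotient_exact:
  "fps_const \<alpha> * exp_quotient g = fps_compose exp_\<alpha> (const_coeffs g) - 1"
proof (rule fps_ext)
  fix n
  have dvd_exp: "\<alpha> dvd smult (1 / fact i) (\<alpha> ^ i)" if "i > 0" for i :: nat
    using that by (intro dvd_smult dvd_power) auto
  have "\<alpha> dvd fps_nth (fps_compose exp_\<alpha> (const_coeffs g) - 1) n"
  proof -
    have "fps_nth (fps_compose exp_\<alpha> (const_coeffs g) - 1) n =
            (\<Sum>i = 1..n. smult (1 / fact i) (\<alpha> ^ i) * fps_nth (const_coeffs g ^ i) n)"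
      by (simp add: fps_compose_nth exp_\<alpha>_def sum.atLeast_Suc_atMost)
    also have "\<alpha> dvd \<dots>"
      by (intro dvd_sum dvd_mult2 dvd_exp) auto
    finally show ?thesis .
  qed
  then show "fps_nth (fps_const \<alpha> * exp_quotient g) n =
      fps_nth (fps_compose exp_\<alpha> (const_coeffs g) - 1) n"
    by (simp only: exp_quotient_def fps_mult_left_const_nth fps_nth_Abs_fps dvd_mult_div_cancel)
qed

lemma poly_exp_quotient:
  assumes "a \<noteq> 0"
  shows "Abs_fps (\<lambda>n. poly (fps_nth (exp_quotient g) n) a) =
           fps_const (1 / a) * (fps_compose (fps_exp a) g - 1)"
proof (rule fps_ext)
  fix n
  have const_nth: "fps_nth (const_coeffs f) m = [:fps_nth f m:]" for f m
    by (simp add: const_coeffs_def)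
  have pow: "const_coeffs g ^ i = const_coeffs (g ^ i)" for i
  proof (induction i)
    case 0
    show ?case by (rule fps_ext) (simp add: const_coeffs_def one_pCons)
  next
    case (Suc i)
    have "const_coeffs g * const_coeffs (g ^ i) = const_coeffs (g * g ^ i)"
      by (rule fps_ext, rule poly_eqI)
         (simp add: const_coeffs_def fps_mult_nth coeff_sum coeff_pCons mult.commute split: nat.splits)
    with Suc show ?case by simp
  qed
  have "a * poly (fps_nth (exp_quotient g) n) a =
          poly (fps_nth (fps_const \<alpha> * exp_quotient g) n) a"
    by simp
  also have "\<dots> = poly (fps_nth (fps_compose exp_\<alpha> (const_coeffs g) - 1) n) a"
    by (simp only: exp_quotient_exact)
  also have "\<dots> = fps_nth (fps_compose (fps_exp a) g - 1) n"
    by (simp add: fps_compose_nth pow poly_sum exp_\<alpha>_def const_nth mult.commute)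
  finally show "fps_nth (Abs_fps (\<lambda>n. poly (fps_nth (exp_quotient g) n) a)) n =
      fps_nth (fps_const (1 / a) * (fps_compose (fps_exp a) g - 1)) n"
    using assms by (cases "n = 0") (auto simp: field_simps)
qed

text \<open>The product \<open>binom (z/p + c) k * p\<^sup>k\<close>, read so that it makes sense for \<open>p = 0\<close> as well.\<close>

definition binom_pow :: "complex \<Rightarrow> complex poly \<Rightarrow> complex \<Rightarrow> nat \<Rightarrow> complex poly" where
  "binom_pow p z c k = smult (1 / fact k) (\<Prod>j<k. z + [:(c - of_nat j) * p:])"

lemma poly_binom_pow:
  assumes "p \<noteq> 0"
  shows "poly (binom_pow p z c k) a = ((poly z a / p + c) gchoose k) * p ^ k"
proof -
  have "(\<Prod>j<k. poly z a + (c - of_nat j) * p) = (\<Prod>j<k. (poly z a / p + c - of_nat j) * p)"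
    using assms by (intro prod.cong) (auto simp: field_simps)
  also have "\<dots> = (\<Prod>j<k. poly z a / p + c - of_nat j) * p ^ k"
    by (simp add: prod.distrib)
  finally show ?thesis
    by (simp add: binom_pow_def poly_prod gbinomial_prod_rev atLeast0LessThan)
qed

text \<open>\<open>series1 c\<close> is the sum of \<open>(x\<^sup>n / n) * c n\<close> over \<open>n \<ge> 1\<close>.\<close>

definition series1 :: "(nat \<Rightarrow> complex poly) \<Rightarrow> complex poly fps" where
  "series1 c = Abs_fps (\<lambda>n. if n = 0 then 0 else smult (1 / of_nat n) (c n))"

end

(* Put t = (e^(pu) - 1) / p, so that e^u = (1 + p t)^(1/p).  Each of the four series y_p, T y_p,
   T^2 y_p and y_p y_p' is G(t) for an explicit G = t / phi(t), with
     phi = (1 + p t)^(1/p),  1 + (p - 1) t,  (1 + p t) / (1 + (p - 1) t)  and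
     (1 + p t)^(2/p) / (1 + (p - 1) t)  respectively.
   If f = G(t(u)), then e^(alpha f^inv) is (1 + p t)^(alpha/p) evaluated at t = G^inv(x), whose
   coefficients are given by Lagrange inversion applied to G; since
   d/dt (1 + p t)^(alpha/p) = alpha (1 + p t)^(alpha/p - 1), n times the n-th coefficient is alpha times
   the coefficient of t^(n-1) in (1 + p t)^(alpha/p - 1) phi(t)^n.  The polynomial identities in alpha
   follow by comparing values at all nonzero alpha. *)
theory Submission
  imports Defs
begin

unbundle fps_syntax

section \<open>Lagrange inversion over a field of characteristic zero\<close>

text \<open>Since \<open>b ^ i\<close> has no terms below degree i, every inner sum may run up to
  the same bound n, and the two sums can be swapped. This allows expanding \<open>a\<close> term by
  term under a further factor \<open>r\<close>.\<close>

lemma fps_compose_mult_nth: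
  fixes a b r :: "'a :: idom fps"
  assumes "b $ 0 = 0"
  shows "((a oo b) * r) $ n = (\<Sum>i\<le>n. a $ i * (b ^ i * r) $ n)"
proof -
  have "((a oo b) * r) $ n = (\<Sum>j\<le>n. (\<Sum>i\<le>n. a $ i * (b ^ i) $ j) * r $ (n - j))"
    unfolding fps_mult_nth atLeast0AtMost fps_compose_nth
  proof (intro sum.cong refl)
    fix j assume "j \<in> {..n}"
    then have "(\<Sum>i\<le>j. a $ i * (b ^ i) $ j) = (\<Sum>i\<le>n. a $ i * (b ^ i) $ j)"
      using startsby_zero_power_prefix[OF assms] by (intro sum.mono_neutral_left) auto
    then show "(\<Sum>i\<le>j. a $ i * (b ^ i) $ j) * r $ (n - j) = (\<Sum>i\<le>n. a $ i * (b ^ i) $ j) * r $ (n - j)"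
      by simp
  qed
  also have "\<dots> = (\<Sum>i\<le>n. a $ i * (b ^ i * r) $ n)"
    unfolding fps_mult_nth atLeast0AtMost sum_distrib_right sum_distrib_left
    by (subst sum.swap) (simp add: mult.assoc)
  finally show ?thesis .
qed

text \<open>For \<open>m > 0\<close>, the residue of \<open>G' / G\<^bsup>m+1\<^esup>\<close> vanishes, written without Laurent series.\<close>

lemma residue_deriv_div_power:
  fixes G \<phi> :: "'a :: field_char_0 fps"
  assumes G: "G * \<phi> = fps_X" and "m > 0"
  shows "(fps_deriv G * \<phi> ^ Suc m) $ m = 0"
proof -
  have "fps_deriv G * \<phi> + G * fps_deriv \<phi> = 1"
    using arg_cong[OF G, of fps_deriv] by (simp add: add.commute)
  then have "fps_deriv G * \<phi> ^ Suc m = (1 - G * fps_deriv \<phi>) * \<phi> ^ m"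
    by (simp add: eq_diff_eq[symmetric] mult.assoc[symmetric])
  also have "\<dots> = \<phi> ^ m - fps_X * (fps_deriv \<phi> * \<phi> ^ (m - 1))"
    using \<open>m > 0\<close> by (cases m) (simp_all add: algebra_simps flip: G)
  finally have eq: "fps_deriv G * \<phi> ^ Suc m = \<phi> ^ m - fps_X * (fps_deriv \<phi> * \<phi> ^ (m - 1))" .
  \<comment> \<open>The operator X d/dX multiplies the m-th coefficient by m, and m can be cancelled
    in characteristic zero. So the two terms of \<open>eq\<close> have the same m-th
    coefficient.\<close>
  have "of_nat m * (fps_X * (fps_deriv \<phi> * \<phi> ^ (m - 1))) = fps_X * fps_deriv (\<phi> ^ m)"
    by (simp add: fps_deriv_power' algebra_simps)
  then have "(of_nat m * (fps_X * (fps_deriv \<phi> * \<phi> ^ (m - 1)))) $ m = of_nat m * (\<phi> ^ m) $ m"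
    using \<open>m > 0\<close> by (simp add: fps_mult_fps_X_deriv_shift)
  then have "(fps_X * (fps_deriv \<phi> * \<phi> ^ (m - 1))) $ m = (\<phi> ^ m) $ m"
    using \<open>m > 0\<close> by (simp only: fps_mult_of_nat_nth) simp
  then show ?thesis
    unfolding eq by simp
qed

lemma fps_inv_nth_0 [simp]: "fps_inv f $ 0 = 0"
  by (simp add: fps_inv_def)

text \<open>With A = H o G^inv, the chain rule gives H' phi^n = (A' o G) G' phi^n. Expanding A' in
  powers of G leaves multiples of residues of G' / G^(j+1), which vanish unless j = 0, so only the
  coefficient of A' at n - 1 survives.\<close>

theorem lagrange_inversion:
  fixes G \<phi> H :: "'a :: field_char_0 fps"
  assumes G: "G * \<phi> = fps_X" and G0: "G $ 0 = 0" and "n > 0"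
  shows "of_nat n * (H oo fps_inv G) $ n = (fps_deriv H * \<phi> ^ n) $ (n - 1)"
proof -
  have G1: "G $ 1 * \<phi> $ 0 = 1"
    using arg_cong[OF G, of "\<lambda>f. f $ 1"] G0 by (simp add: fps_mult_nth_1)
  then have "G $ 1 \<noteq> 0" by auto
  define A where "A = H oo fps_inv G"
  obtain m where n: "n = Suc m" using \<open>n > 0\<close> by (cases n) auto
  have "H = A oo G"
    using fps_compose_assoc[of G "fps_inv G" H] fps_inv[OF G0 \<open>G $ 1 \<noteq> 0\<close>] G0
    by (simp add: A_def)
  then have "fps_deriv H * \<phi> ^ n = (fps_deriv A oo G) * (fps_deriv G * \<phi> ^ n)"
    using G0 by (simp add: fps_compose_deriv mult.assoc)
  then have "(fps_deriv H * \<phi> ^ n) $ m =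
      (\<Sum>i\<le>m. fps_deriv A $ i * (G ^ i * (fps_deriv G * \<phi> ^ n)) $ m)"
    using G0 by (simp only: fps_compose_mult_nth)
  also have "\<dots> = (\<Sum>i\<le>m. if i = m then fps_deriv A $ m else 0)"
  proof (intro sum.cong refl)
    fix i assume "i \<in> {..m}"
    then obtain j where j: "m = i + j" using le_Suc_ex by auto
    have nth: "(fps_X ^ i * R) $ m = R $ j" for R :: "'a fps"
      by (simp add: j fps_X_power_mult_nth)
    \<comment> \<open>Each factor G absorbs one of the n = i + j + 1 factors phi and becomes X. At j
      = 0 what remains is \<open>G $ 1 * \<phi> $ 0 = 1\<close>.\<close>
    have "G ^ i * (fps_deriv G * \<phi> ^ n) = (G * \<phi>) ^ i * (fps_deriv G * \<phi> ^ Suc j)"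
      by (simp add: n j power_add power_mult_distrib algebra_simps)
    then have "(G ^ i * (fps_deriv G * \<phi> ^ n)) $ m = (fps_deriv G * \<phi> ^ Suc j) $ j"
      by (simp only: G nth)
    also have "\<dots> = (if j = 0 then 1 else 0)"
      using residue_deriv_div_power[OF G, of j] G1 by simp
    finally show "fps_deriv A $ i * (G ^ i * (fps_deriv G * \<phi> ^ n)) $ m =
        (if i = m then fps_deriv A $ m else 0)"
      by (auto simp: j)
  qed
  finally show ?thesis
    by (simp add: n A_def)
qed

section \<open>Compositional inverses\<close>

lemma fps_inv_unique:
  fixes f g :: "'a :: field fps"
  assumes "f $ 0 = 0" "f $ 1 \<noteq> 0" "g oo f = fps_X"
  shows "fps_inv f = g"
  using fps_compose_inj_right[OF assms(1,2), of "fps_inv f" g] fps_inv[OF assms(1,2)] assms(3)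
  by simp

lemma fps_inv_compose:
  fixes f g :: "'a :: field fps"
  assumes f: "f $ 0 = 0" "f $ 1 \<noteq> 0" and g: "g $ 0 = 0" "g $ 1 \<noteq> 0"
  shows "fps_inv (f oo g) = fps_inv g oo fps_inv f"
proof (rule fps_inv_unique)
  show "(f oo g) $ 1 \<noteq> 0"
    using f g by (simp add: fps_compose_nth)
  have "(fps_inv g oo fps_inv f) oo (f oo g) = fps_inv g oo (fps_inv f oo f oo g)"
    using f g by (simp add: fps_compose_assoc)
  also have "\<dots> = fps_X"
    using f g by (simp add: fps_inv)
  finally show "(fps_inv g oo fps_inv f) oo (f oo g) = fps_X" .
qed (use f in auto)

section \<open>The power (1 + p t)^(a/p) as a series in t\<close>

text \<open>\<open>pexp p a\<close> is \<open>(1 + p t)\<^bsup>a/p\<^esup>\<close>, which degenerates to \<open>e\<^bsup>at\<^esup>\<close> for \<open>p = 0\<close>.\<close>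

definition exp_var :: "'a :: field_char_0 \<Rightarrow> 'a fps" where
  "exp_var p = (if p = 0 then fps_X else fps_const (1 / p) * (fps_exp p - 1))"

definition pexp :: "'a :: field_char_0 \<Rightarrow> 'a \<Rightarrow> 'a fps" where
  "pexp p a = fps_exp a oo fps_inv (exp_var p)"

lemma exp_var_nth_0 [simp]: "exp_var p $ 0 = 0"
  and exp_var_nth_1 [simp]: "exp_var p $ Suc 0 = 1"
  by (simp_all add: exp_var_def)

lemma fps_exp_eq_exp_var: "fps_exp p = 1 + fps_const p * exp_var p"
  by (auto simp: exp_var_def fps_eq_iff)

lemma fps_deriv_exp_var: "fps_deriv (exp_var p) = fps_exp p"
  by (simp add: exp_var_def)

lemma pexp_compose_exp_var: "pexp p a oo exp_var p = fps_exp a"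
  by (simp add: pexp_def fps_inv flip: fps_compose_assoc)

lemma pexp_0 [simp]: "pexp p 0 = 1"
  by (simp add: pexp_def)

lemma pexp_add: "pexp p (a + b) = pexp p a * pexp p b"
  by (simp add: pexp_def fps_exp_add_mult fps_compose_mult_distrib)

lemma pexp_power: "pexp p a ^ n = pexp p (of_nat n * a)"
  by (simp add: pexp_def fps_compose_power fps_exp_power_mult)

lemma pexp_self: "pexp p p = 1 + fps_const p * fps_X"
proof -
  have "pexp p p = (1 + fps_const p * exp_var p) oo fps_inv (exp_var p)"
    unfolding pexp_def by (subst fps_exp_eq_exp_var) (rule refl)
  also have "\<dots> = 1 + fps_const p * fps_X"
    by (simp add: fps_compose_add_distrib fps_compose_mult_distrib fps_inv_right)
  finally show ?thesis .
qed

lemma pexp_nth_0 [simp]: "pexp p a $ 0 = 1"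
  by (simp add: pexp_def)

text \<open>Since dt/du = e^(pu), the inverse series has derivative du/dt = (1 + p t)^(-1); the
  chain rule then lowers the exponent parameter by p.\<close>

lemma fps_deriv_pexp: "fps_deriv (pexp p a) = fps_const a * pexp p (a - p)"
proof -
  have 1: "pexp p p * pexp p (- p) = 1"
    by (simp flip: pexp_add)
  have "fps_deriv (fps_inv (exp_var p)) = inverse (pexp p p)"
    by (simp add: fps_inv_deriv fps_deriv_exp_var pexp_def)
  also have "\<dots> = pexp p (- p)"
    using fps_inverse_unique[OF 1] .
  finally show ?thesis
    using pexp_add[of p a "- p"]
    by (simp add: pexp_def fps_compose_deriv fps_compose_mult_distrib mult.assoc)
qed

text \<open>Each differentiation contributes the current parameter as a factor and lowers it by p.
  For nonzero p this is the binomial series.\<close>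

lemma pexp_nth: "pexp p a $ n = (\<Prod>j<n. a - of_nat j * p) / fact n"
proof (induction n arbitrary: a)
  case (Suc n)
  have "of_nat (Suc n) * pexp p a $ Suc n = a * pexp p (a - p) $ n"
    using arg_cong[OF fps_deriv_pexp, of "\<lambda>f. f $ n" p a] by simp
  also have "\<dots> = (\<Prod>j<Suc n. a - of_nat j * p) / fact n"
    unfolding Suc prod.lessThan_Suc_shift by (simp add: algebra_simps)
  finally show ?case
    by (simp add: field_simps del: of_nat_Suc)
qed simp

text \<open>Makes the right-hand sides comparable with coefficients of products of series, also at p
  = 0.\<close>

lemma poly_binom_pow_eq_pexp: "poly (binom_pow p z c k) a = pexp p (poly z a + c * p) $ k"
  by (simp add: binom_pow_def pexp_nth poly_prod algebra_simps)

section \<open>Reduction of each formula to one coefficient\<close>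

text \<open>Inverting f = G o t turns e^(a f^inv) into \<open>pexp p a\<close> composed with G^inv.
  The factor a from differentiating \<open>pexp p a\<close> cancels the division by alpha, which
  leaves only the coefficient in \<open>c\<close> to compute.\<close>

lemma exp_quotient_fps_inv_eqI:
  assumes f: "f = G oo exp_var p" and G: "G * \<phi> = fps_X" and G0: "G $ 0 = 0"
    and c: "\<And>n a. n > 0 \<Longrightarrow> (pexp p (a - p) * \<phi> ^ n) $ (n - 1) = poly (c n) a"
  shows "exp_quotient (fps_inv f) = series1 c"
proof (rule fps_ext)
  fix n
  have G1: "G $ 1 \<noteq> 0"
    using arg_cong[OF G, of "\<lambda>f. f $ 1"] G0 by (auto simp: fps_mult_nth_1)
  show "exp_quotient (fps_inv f) $ n = series1 c $ n"
  proof (cases "n = 0")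
    case True
    then show ?thesis
      by (simp add: exp_quotient_def series1_def exp_\<alpha>_def one_pCons)
  next
    case False
    let ?P = "exp_quotient (fps_inv f) $ n" and ?Q = "smult (1 / of_nat n) (c n)"
    have "poly ?P a = poly ?Q a" if "a \<noteq> 0" for a
    proof -
      have "fps_exp a oo fps_inv f = pexp p a oo fps_inv G"
        using G0 G1 by (simp add: f pexp_def fps_inv_compose fps_compose_assoc)
      then have "of_nat n * (fps_exp a oo fps_inv f) $ n = a * (pexp p (a - p) * \<phi> ^ n) $ (n - 1)"
        using lagrange_inversion[OF G G0, of n "pexp p a"] False
        by (simp add: fps_deriv_pexp mult.assoc)
      also have "\<dots> = a * poly (c n) a"
        using c False by simp
      finally have "(fps_exp a oo fps_inv f) $ n = a * poly (c n) a / of_nat n"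
        using False by (simp add: field_simps)
      moreover have "poly ?P a = (1 / a) * (fps_exp a oo fps_inv f) $ n"
        using arg_cong[OF poly_exp_quotient[OF that], of "\<lambda>f. f $ n" "fps_inv f"] False by simp
      ultimately show ?thesis
        using that by simp
    qed
    then have "- {0} \<subseteq> {a. poly (?P - ?Q) a = 0}"
      by auto
    moreover have "infinite (- {0 :: complex})"
      by (simp add: infinite_UNIV_char_0)
    ultimately have "infinite {a. poly (?P - ?Q) a = 0}"
      using finite_subset by blast
    then have "?P - ?Q = 0"
      using poly_roots_finite by blast
    then show ?thesis
      using False by (simp add: series1_def)
  qed
qed

section \<open>The four series in the variable t\<close>

lemma one_plus_const_fps_X_power_nth:
  fixes c :: "'a :: field_char_0"
  shows "((1 + fps_const c * fps_X) ^ n) $ k = of_nat (n choose k) * c ^ k"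
proof -
  have "(1 + fps_const c * fps_X) ^ n = ((1 + fps_X) ^ n) oo (fps_const c * fps_X)"
    by (simp add: fps_compose_add_distrib flip: fps_compose_power)
  then show ?thesis
    by (simp add: fps_compose_linear binomial_gbinomial flip: fps_binomial_of_nat)
qed

text \<open>Differentiating G o t in u produces the extra factor e^(pu) = 1 + p t. In the variable t
  the operator is therefore G -> G / (G' (1 + p t)), stated here without division.\<close>

lemma \<TT>_compose_exp_var:
  assumes "H * fps_deriv G = G * pexp p (- p)" "fps_deriv G $ 0 \<noteq> 0"
  shows "\<TT> (G oo exp_var p) = H oo exp_var p"
proof -
  have "(H oo exp_var p) * fps_deriv (G oo exp_var p) = ((H * fps_deriv G) oo exp_var p) * fps_exp p"
    by (simp add: fps_compose_deriv fps_compose_mult_distrib fps_deriv_exp_var mult.assoc)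
  also have "\<dots> = (G oo exp_var p) * (fps_exp (- p) * fps_exp p)"
    unfolding assms by (simp add: fps_compose_mult_distrib pexp_compose_exp_var mult.assoc)
  also have "\<dots> = G oo exp_var p"
    by (simp flip: fps_exp_add_mult)
  finally have "(H oo exp_var p) * fps_deriv (G oo exp_var p) = G oo exp_var p" .
  moreover have "fps_deriv (G oo exp_var p) $ 0 \<noteq> 0"
    using assms(2) by (simp add: fps_compose_nth)
  then have "fps_deriv (G oo exp_var p) \<noteq> 0" by (metis fps_zero_nth)
  ultimately show ?thesis
    unfolding \<TT>_def by (metis nonzero_mult_div_cancel_right)
qed

theorem theorem4p5:
  fixes p :: complex
  shows "exp_quotient (fps_inv (y_series p)) =
      series1 (\<lambda>n. binom_pow p (\<alpha> + of_nat n) (-1) (n - 1)) \<and>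
    exp_quotient (fps_inv (\<TT> (y_series p))) =
      series1 (\<lambda>n. \<Sum>k=0..n-1. binom_pow p \<alpha> (-1) k * of_nat (n choose (k + 1))
                      * [:(p - 1) ^ (n - 1 - k):]) \<and>
    exp_quotient (fps_inv ((\<TT> \<circ> \<TT>) (y_series p))) =
      series1 (\<lambda>n. \<Sum>k=0..n-1. binom_pow p \<alpha> (of_nat n - 1) k
                      * of_nat ((2 * n - k - 2) choose (n - 1)) * [:(1 - p) ^ (n - 1 - k):]) \<and>
    exp_quotient (fps_inv (y_series p * fps_deriv (y_series p))) =
      series1 (\<lambda>n. \<Sum>k=0..n-1. binom_pow p (\<alpha> + of_nat (2 * n) - [:p:]) 0 k
                      * of_nat ((2 * n - k - 2) choose (n - 1)) * [:(1 - p) ^ (n - 1 - k):])"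
proof -
  \<comment> \<open>\<open>D\<close> is (1 + p t) - t, the factor that appears when t (1 + p
    t)^(-1/p) is differentiated.\<close>
  define D where "D = 1 + fps_const (p - 1) * fps_X"
  define G1 where "G1 = fps_X * pexp p (- 1)"
  define G2 where "G2 = fps_X * inverse D"
  define G3 where "G3 = fps_X * D * pexp p (- p)"
  define G4 where "G4 = fps_X * pexp p (- 2) * D"
  have D0: "D $ 0 = 1" by (simp add: D_def)
  have DD: "inverse D * D = 1" "D * inverse D = 1"
    using inverse_mult_eq_1[of D] D0 by (simp_all add: mult.commute)
  have D': "fps_deriv D = fps_const (p - 1)" by (simp add: D_def)
  have D_eq: "pexp p p - fps_X = D"
    by (simp add: D_def pexp_self algebra_simps flip: fps_const_sub)
  have G1': "fps_deriv G1 = pexp p (- 1 - p) * D"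
  proof -
    have "fps_deriv G1 = pexp p (- 1) - fps_X * pexp p (- 1 - p)"
      by (simp add: G1_def fps_deriv_pexp flip: fps_const_neg)
    also have "pexp p (- 1) = pexp p (- 1 - p) * pexp p p"
      by (simp flip: pexp_add)
    finally show ?thesis
      by (simp add: algebra_simps flip: D_eq)
  qed
  have G2': "fps_deriv G2 = inverse D * inverse D"
  proof -
    have "fps_deriv G2 = inverse D - inverse D * inverse D * (fps_X * fps_const (p - 1))"
      using D0 by (simp add: G2_def fps_inverse_deriv D' power2_eq_square mult_ac flip: fps_const_neg)
    also have "\<dots> = inverse D * inverse D * (D - fps_X * fps_const (p - 1))"
      using DD by (simp add: right_diff_distrib mult.assoc)
    also have "D - fps_X * fps_const (p - 1) = 1"
      by (simp add: D_def mult.commute)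
    finally show ?thesis by simp
  qed
  have y: "y_series p = G1 oo exp_var p"
    by (simp add: y_series_def G1_def fps_compose_mult_distrib pexp_compose_exp_var)
       (simp add: exp_var_def)
  have Ty: "\<TT> (y_series p) = G2 oo exp_var p"
    unfolding y
  proof (rule \<TT>_compose_exp_var)
    have "G2 * fps_deriv G1 = fps_X * pexp p (- 1 - p)"
      using DD by (simp add: G2_def G1' mult_ac)
    also have "\<dots> = G1 * pexp p (- p)"
      by (simp add: G1_def mult.assoc flip: pexp_add)
    finally show "G2 * fps_deriv G1 = G1 * pexp p (- p)" .
  qed (simp add: G1' D0)
  have TTy: "(\<TT> \<circ> \<TT>) (y_series p) = G3 oo exp_var p"
    unfolding comp_def Ty
  proof (rule \<TT>_compose_exp_var)
    \<comment> \<open>The derivative of \<open>G2\<close> is D^(-2), so dividing \<open>G2\<close> =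
      X / D by it leaves X D.\<close>
    have "G3 * fps_deriv G2 = fps_X * pexp p (- p) * (D * inverse D) * inverse D"
      unfolding G2' by (simp add: G3_def mult_ac)
    then show "G3 * fps_deriv G2 = G2 * pexp p (- p)"
      by (simp add: DD G2_def mult_ac)
  qed (simp add: G2' D0)
  \<comment> \<open>The derivative in u brings in \<open>pexp p p\<close>, and the exponent
    parameters add up to -1 + (-1 - p) + p = -2.\<close>
  have yy': "y_series p * fps_deriv (y_series p) = G4 oo exp_var p"
  proof -
    have "y_series p * fps_deriv (y_series p) = (G1 * fps_deriv G1 * pexp p p) oo exp_var p"
      by (simp add: y fps_compose_deriv fps_compose_mult_distrib fps_deriv_exp_var
          pexp_compose_exp_var mult.assoc)
    also have "G1 * fps_deriv G1 * pexp p p = fps_X * D * (pexp p (- 1) * pexp p (- 1 - p) * pexp p p)"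
      unfolding G1' by (simp add: G1_def mult_ac)
    also have "\<dots> = G4"
      by (simp add: G4_def mult_ac flip: pexp_add)
    finally show ?thesis .
  qed
  have inverse_D_power: "(inverse D ^ n) $ k = of_nat ((n + k - 1) choose k) * (1 - p) ^ k"
    if "n > 0" for n k
  proof -
    have "D = 1 - fps_const (1 - p) * fps_X"
      by (simp add: D_def algebra_simps flip: fps_const_sub)
    then show ?thesis
      using one_minus_const_fps_X_neg_power'[OF that, of "1 - p"] by (simp flip: fps_inverse_power)
  qed
  have mult_inverse_D_power: "(pexp p b * inverse D ^ n) $ (n - 1) =
      (\<Sum>k=0..n-1. pexp p b $ k * of_nat ((2 * n - k - 2) choose (n - 1)) * (1 - p) ^ (n - 1 - k))"
    if "n > 0" for n b
    unfolding fps_mult_nth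
  proof (intro sum.cong refl)
    \<comment> \<open>The negative binomial series gives the lower index n - 1 - k; its complement
      in 2n - k - 2 is n - 1.\<close>
    fix k assume "k \<in> {0..n-1}"
    then have "n + (n - 1 - k) - 1 = 2 * n - k - 2" "(2 * n - k - 2) - (n - 1 - k) = n - 1"
      "n - 1 - k \<le> 2 * n - k - 2"
      using that by auto
    then have "(n + (n - 1 - k) - 1) choose (n - 1 - k) = (2 * n - k - 2) choose (n - 1)"
      by (metis binomial_symmetric)
    then show "pexp p b $ k * (inverse D ^ n) $ (n - 1 - k) =
        pexp p b $ k * of_nat ((2 * n - k - 2) choose (n - 1)) * (1 - p) ^ (n - 1 - k)"
      using inverse_D_power[OF that] by simp
  qed
  have 1: "exp_quotient (fps_inv (y_series p)) =
      series1 (\<lambda>n. binom_pow p (\<alpha> + of_nat n) (-1) (n - 1))"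
  proof (rule exp_quotient_fps_inv_eqI[OF y, where \<phi> = "pexp p 1"])
    fix n :: nat and a
    \<comment> \<open>The total parameter a - p + n is read as (a + n) + (-1) p.\<close>
    show "(pexp p (a - p) * pexp p 1 ^ n) $ (n - 1) = poly (binom_pow p (\<alpha> + of_nat n) (-1) (n - 1)) a"
      by (simp add: poly_binom_pow_eq_pexp pexp_power algebra_simps flip: pexp_add)
  qed (simp_all add: G1_def mult.assoc flip: pexp_add)
  have 2: "exp_quotient (fps_inv (\<TT> (y_series p))) =
      series1 (\<lambda>n. \<Sum>k=0..n-1. binom_pow p \<alpha> (-1) k * of_nat (n choose (k + 1))
                      * [:(p - 1) ^ (n - 1 - k):])"
  proof (rule exp_quotient_fps_inv_eqI[OF Ty, where \<phi> = D])
    fix n :: nat and a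
    assume n: "n > 0"
    have "(pexp p (a - p) * D ^ n) $ (n - 1) =
        (\<Sum>k=0..n-1. pexp p (a - p) $ k * (of_nat (n choose (n - 1 - k)) * (p - 1) ^ (n - 1 - k)))"
      unfolding D_def fps_mult_nth one_plus_const_fps_X_power_nth ..
    also have "\<dots> = (\<Sum>k=0..n-1. pexp p (a - p) $ k * (of_nat (n choose (k + 1)) * (p - 1) ^ (n - 1 - k)))"
    proof (intro sum.cong refl)
      \<comment> \<open>The complement of n - 1 - k in n is k + 1.\<close>
      fix k assume "k \<in> {0..n-1}"
      then have "n choose (n - 1 - k) = n choose (k + 1)"
        using n by (subst binomial_symmetric) auto
      then show "pexp p (a - p) $ k * (of_nat (n choose (n - 1 - k)) * (p - 1) ^ (n - 1 - k)) =
          pexp p (a - p) $ k * (of_nat (n choose (k + 1)) * (p - 1) ^ (n - 1 - k))"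
        by simp
    qed
    finally show "(pexp p (a - p) * D ^ n) $ (n - 1) =
        poly (\<Sum>k=0..n-1. binom_pow p \<alpha> (-1) k * of_nat (n choose (k + 1)) * [:(p - 1) ^ (n - 1 - k):]) a"
      by (simp add: poly_sum poly_binom_pow_eq_pexp mult_ac)
  qed (simp_all add: G2_def mult.assoc DD)
  have 3: "exp_quotient (fps_inv ((\<TT> \<circ> \<TT>) (y_series p))) =
      series1 (\<lambda>n. \<Sum>k=0..n-1. binom_pow p \<alpha> (of_nat n - 1) k
                      * of_nat ((2 * n - k - 2) choose (n - 1)) * [:(1 - p) ^ (n - 1 - k):])"
  proof (rule exp_quotient_fps_inv_eqI[OF TTy, where \<phi> = "pexp p p * inverse D"])
    have "G3 * (pexp p p * inverse D) = fps_X * (D * inverse D) * (pexp p (- p) * pexp p p)"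
      by (simp add: G3_def mult_ac)
    then show "G3 * (pexp p p * inverse D) = fps_X"
      by (simp add: DD flip: pexp_add)
    fix n :: nat and a
    assume n: "n > 0"
    \<comment> \<open>The n factors \<open>pexp p p\<close> raise a - p to a + (n - 1) p, whence the
      shift n - 1 in the binomial.\<close>
    have "pexp p (a - p) * (pexp p p * inverse D) ^ n = pexp p (a + (of_nat n - 1) * p) * inverse D ^ n"
      by (simp add: power_mult_distrib pexp_power algebra_simps flip: pexp_add mult.assoc)
    then show "(pexp p (a - p) * (pexp p p * inverse D) ^ n) $ (n - 1) =
        poly (\<Sum>k=0..n-1. binom_pow p \<alpha> (of_nat n - 1) k
                      * of_nat ((2 * n - k - 2) choose (n - 1)) * [:(1 - p) ^ (n - 1 - k):]) a"
      using mult_inverse_D_power[OF n, of "a + (of_nat n - 1) * p"]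
      by (simp add: poly_sum poly_binom_pow_eq_pexp mult.commute)
  qed (simp add: G3_def)
  have 4: "exp_quotient (fps_inv (y_series p * fps_deriv (y_series p))) =
      series1 (\<lambda>n. \<Sum>k=0..n-1. binom_pow p (\<alpha> + of_nat (2 * n) - [:p:]) 0 k
                      * of_nat ((2 * n - k - 2) choose (n - 1)) * [:(1 - p) ^ (n - 1 - k):])"
  proof (rule exp_quotient_fps_inv_eqI[OF yy', where \<phi> = "pexp p 2 * inverse D"])
    have "G4 * (pexp p 2 * inverse D) = fps_X * (D * inverse D) * (pexp p (- 2) * pexp p 2)"
      by (simp add: G4_def mult_ac)
    then show "G4 * (pexp p 2 * inverse D) = fps_X"
      by (simp add: DD flip: pexp_add)
    fix n :: nat and a
    assume n: "n > 0"
    \<comment> \<open>Here the -p stays inside the polynomial argument, so the shift of the binomial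
      is 0.\<close>
    have "pexp p (a - p) * (pexp p 2 * inverse D) ^ n = pexp p (a + of_nat (2 * n) - p) * inverse D ^ n"
      by (simp add: power_mult_distrib pexp_power algebra_simps flip: pexp_add mult.assoc)
    then show "(pexp p (a - p) * (pexp p 2 * inverse D) ^ n) $ (n - 1) =
        poly (\<Sum>k=0..n-1. binom_pow p (\<alpha> + of_nat (2 * n) - [:p:]) 0 k
                      * of_nat ((2 * n - k - 2) choose (n - 1)) * [:(1 - p) ^ (n - 1 - k):]) a"
      using mult_inverse_D_power[OF n, of "a + of_nat (2 * n) - p"]
      by (simp add: poly_sum poly_binom_pow_eq_pexp mult.commute)
  qed (simp add: G4_def)
  show ?thesis
    using 1 2 3 4 by blast
qed

end
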